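(* Let $X$ be a set, let $\{*_1,\dots,*_k\}\subset Bin(X)$ be a finite distributive set of binary operations on $X$, and let $a_1,\dots,a_k\in\mathbb Z$. Put $d_i^{(a_1,\dots,a_k)}=\sum_{j=1}^k a_j d_i^{( *_j)}$ and $\partial^{(a_1,\dots,a_k)}=\sum_{j=1}^k a_j\partial^{( *_j)}$. Then $(C_n,d_i^{(a_1,\dots,a_k)})$ is a presimplicial module and $(C_n,\partial_n^{(a_1,\dots,a_k)})$ is a chain complex.
   Context: $Bin(X)$ is the set of all binary operations on $X$. A set of operations $S\subset Bin(X)$ is distributive if for all $*_\alpha,*_\beta\in S$ (including $*_\alpha=*_\beta$) and all $a,b,c\in X$, $(a*_\alpha b)*_\beta c=(a*_\beta c)*_\alpha(b*_\beta c)$. $C_n=\mathbb Z X^{n+1}$ is the free abelian group on $X^{n+1}$ for $n\ge 0$. For a binary operation $*$ the face maps $d_i^{( * )}:C_n\to C_{n-1}$, $0\le i\le n$ ($n\geq 1$), are the linear maps with $d_0^{( * )}(x_0,\dots,x_n)=(x_1,\dots,x_n)$ and $d_i^{( * )}(x_0,\dots,x_n)=(x_0*x_i,\dots,x_{i-1}*x_i,x_{i+1},\dots,x_n)$ for $0<i\le n$; and $\partial_n^{( * )}=\sum_{i=0}^n(-1)^id_i^{( * )}$. A presimplicial module is a sequence of modules $C_n$, $n\ge0$, with maps $d_i:C_n\to C_{n-1}$, $0\le i\le n$, satisfying $d_id_j=d_{j-1}d_i$ for $i<j$. *)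

theory Defs
  imports "HOL-Algebra.Free_Abelian_Groups" "HOL-Algebra.IntRing" "HOL-Algebra.Module"
begin

(* Operations are total functions constrained only on X; their values outside X are irrelevant. *)
definition Bin :: "'a set \<Rightarrow> ('a \<Rightarrow> 'a \<Rightarrow> 'a) set" where
  "Bin X = X \<rightarrow> X \<rightarrow> X"

definition distributive_set :: "'a set \<Rightarrow> ('a \<Rightarrow> 'a \<Rightarrow> 'a) set \<Rightarrow> bool" where
  "distributive_set X S \<longleftrightarrow> S \<subseteq> Bin X \<and>
     (\<forall>f\<in>S. \<forall>g\<in>S. \<forall>a\<in>X. \<forall>b\<in>X. \<forall>c\<in>X. g (f a b) c = f (g a c) (g b c))"

definition linear_maps :: "('r, 'm) ring_scheme \<Rightarrow> ('r, 'a, 'n) module_scheme \<Rightarrow>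
    ('r, 'b, 'p) module_scheme \<Rightarrow> ('a \<Rightarrow> 'b) set" where
  "linear_maps R M N = {h \<in> carrier M \<rightarrow> carrier N.
     (\<forall>x\<in>carrier M. \<forall>y\<in>carrier M. h (x \<oplus>\<^bsub>M\<^esub> y) = h x \<oplus>\<^bsub>N\<^esub> h y) \<and>
     (\<forall>r\<in>carrier R. \<forall>x\<in>carrier M. h (r \<odot>\<^bsub>M\<^esub> x) = r \<odot>\<^bsub>N\<^esub> h x)}"

(* d n i is the face map d_i : C_n -> C_(n-1); only n \<ge> 1 and i \<le> n matter. *)
locale presimplicial_module =
  fixes R :: "('r, 'm) ring_scheme"
    and C :: "nat \<Rightarrow> ('r, 'a, 'n) module_scheme"
    and d :: "nat \<Rightarrow> nat \<Rightarrow> 'a \<Rightarrow> 'a"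
  assumes is_module: "\<And>n. module R (C n)"
    and face_linear: "\<And>n i. i \<le> n + 1 \<Longrightarrow> d (n + 1) i \<in> linear_maps R (C (n + 1)) (C n)"
    and face_face: "\<And>n i j x. \<lbrakk>i < j; j \<le> n + 2; x \<in> carrier (C (n + 2))\<rbrakk> \<Longrightarrow>
          d (n + 1) i (d (n + 2) j x) = d (n + 1) (j - 1) (d (n + 2) i x)"

(* bd n is the boundary map C_n -> C_(n-1); only n \<ge> 1 matters. *)
locale module_chain_complex =
  fixes R :: "('r, 'm) ring_scheme"
    and C :: "nat \<Rightarrow> ('r, 'a, 'n) module_scheme"
    and bd :: "nat \<Rightarrow> 'a \<Rightarrow> 'a"
  assumes is_module: "\<And>n. module R (C n)"
    and boundary_linear: "\<And>n. bd (n + 1) \<in> linear_maps R (C (n + 1)) (C n)"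
    and boundary_boundary: "\<And>n x. x \<in> carrier (C (n + 2)) \<Longrightarrow>
          bd (n + 1) (bd (n + 2) x) = \<zero>\<^bsub>C n\<^esub>"

(* Module records extend ring records; the multiplicative fields play no role for modules. *)
definition free_int_module :: "'b set \<Rightarrow> (int, 'b \<Rightarrow>\<^sub>0 int) module" where
  "free_int_module S =
     \<lparr>carrier = carrier (free_Abelian_group S),
      monoid.mult = undefined, one = undefined,
      zero = \<one>\<^bsub>free_Abelian_group S\<^esub>,
      add = (\<lambda>x y. x \<otimes>\<^bsub>free_Abelian_group S\<^esub> y),
      smult = frag_cmul\<rparr>"

(* A point (x_0, ..., x_n) of X^(n+1) is the list [x_0, ..., x_n]. *)
definition chain_module :: "'a set \<Rightarrow> nat \<Rightarrow> (int, 'a list \<Rightarrow>\<^sub>0 int) module" where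
  "chain_module X n = free_int_module {xs. length xs = n + 1 \<and> set xs \<subseteq> X}"

(* For i = 0 nothing precedes x_0, so this is (x_1, ..., x_n), as required. *)
definition face_tuple :: "('a \<Rightarrow> 'a \<Rightarrow> 'a) \<Rightarrow> nat \<Rightarrow> 'a list \<Rightarrow> 'a list" where
  "face_tuple f i xs = map (\<lambda>y. f y (xs ! i)) (take i xs) @ drop (i + 1) xs"

(* The formula for d_i does not depend on the degree n. *)
definition face :: "('a \<Rightarrow> 'a \<Rightarrow> 'a) \<Rightarrow> nat \<Rightarrow> ('a list \<Rightarrow>\<^sub>0 int) \<Rightarrow> ('a list \<Rightarrow>\<^sub>0 int)" where
  "face f i = frag_extend (\<lambda>xs. frag_of (face_tuple f i xs))"

definition boundary :: "('a \<Rightarrow> 'a \<Rightarrow> 'a) \<Rightarrow> nat \<Rightarrow> ('a list \<Rightarrow>\<^sub>0 int) \<Rightarrow> ('a list \<Rightarrow>\<^sub>0 int)" where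
  "boundary f n c = (\<Sum>i=0..n. frag_cmul ((-1) ^ i) (face f i c))"

definition multi_face :: "nat \<Rightarrow> (nat \<Rightarrow> 'a \<Rightarrow> 'a \<Rightarrow> 'a) \<Rightarrow> (nat \<Rightarrow> int) \<Rightarrow>
    nat \<Rightarrow> ('a list \<Rightarrow>\<^sub>0 int) \<Rightarrow> ('a list \<Rightarrow>\<^sub>0 int)" where
  "multi_face k ops a i c = (\<Sum>j=1..k. frag_cmul (a j) (face (ops j) i c))"

definition multi_boundary :: "nat \<Rightarrow> (nat \<Rightarrow> 'a \<Rightarrow> 'a \<Rightarrow> 'a) \<Rightarrow> (nat \<Rightarrow> int) \<Rightarrow>
    nat \<Rightarrow> ('a list \<Rightarrow>\<^sub>0 int) \<Rightarrow> ('a list \<Rightarrow>\<^sub>0 int)" where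
  "multi_boundary k ops a n c = (\<Sum>j=1..k. frag_cmul (a j) (boundary (ops j) n c))"

end

(* Distributivity of every pair of operations in the set, including pairs of different ones, gives
   the mixed identity d_i^(f) d_j^(g) = d_(j-1)^(g) d_i^(f) for i < j. Expanding the composite of
   two combined faces bilinearly turns this into the presimplicial identity, and the alternating
   double sum then vanishes by pairing (i, j), i < j, with (j - 1, i). *)
theory Submission
  imports Defs
begin

text \<open>The rectangle has m + 1 rows and m + 2 columns, so the part strictly above the diagonal
  (\<open>A\<close>) and the rest (\<open>B\<close>) both have (m + 1)(m + 2)/2 cells and can cancel
  in pairs. For the boundary, \<open>F i j\<close> will be the composite of faces i and j applied to
  a chain.\<close>

lemma alternating_double_sum_eq_0:
  fixes F :: "nat \<Rightarrow> nat \<Rightarrow> 'b \<Rightarrow>\<^sub>0 int"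
  assumes F: "\<And>i j. \<lbrakk>i < j; j \<le> m + 1\<rbrakk> \<Longrightarrow> F i j = F (j - 1) i"
  shows "(\<Sum>i=0..m. \<Sum>j=0..m+1. frag_cmul ((-1) ^ (i + j)) (F i j)) = 0"
proof -
  define A where "A = {(i, j). i < j \<and> j \<le> m + 1}"
  define B where "B = {(i, j). j \<le> i \<and> i \<le> m}"
  define G where "G = (\<lambda>(i, j). frag_cmul ((-1) ^ (i + j)) (F i j))"
  have AB: "{0..m} \<times> {0..m+1} = A \<union> B" "A \<inter> B = {}"
    by (auto simp: A_def B_def)
  then have "finite (A \<union> B)"
    by (metis finite_SigmaI finite_atLeastAtMost)
  then have fin: "finite A" "finite B"
    by auto
  have "sum G A = (\<Sum>p\<in>B. - G p)"
  \<comment> \<open>The second witness is the pairing from \<open>A\<close> to \<open>B\<close>, the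
    first its inverse. The index sum drops by one, so the sign flips while \<open>F\<close> keeps
    its value.\<close>
  proof (rule sum.reindex_bij_witness[where i = "\<lambda>(i, j). (j, i + 1)" and j = "\<lambda>(i, j). (j - 1, i)"])
    fix p assume "p \<in> A"
    \<comment> \<open>In \<open>A\<close> the second index is positive; writing it as a successor
      makes the truncated subtraction exact.\<close>
    then obtain i j where p: "p = (i, Suc j)" "i \<le> j" "j \<le> m"
      by (cases p; cases "snd p") (auto simp: A_def)
    show "- G (case p of (i, j) \<Rightarrow> (j - 1, i)) = G p"
      using p F[of i "Suc j"] by (simp add: G_def add.commute)
  qed (auto simp: A_def B_def)
  moreover have "(\<Sum>i=0..m. \<Sum>j=0..m+1. frag_cmul ((-1) ^ (i + j)) (F i j)) = sum G (A \<union> B)"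
    unfolding AB(1)[symmetric] G_def by (rule sum.cartesian_product)
  ultimately show ?thesis
    using fin AB(2) by (simp add: sum.union_disjoint sum_negf)
qed

lemma module_free_int_module: "module int_ring (free_int_module S)"
proof (rule moduleI[OF int_is_cring])
  show "abelian_group (free_int_module S)"
  proof (rule abelian_groupI)
    fix x assume "x \<in> carrier (free_int_module S)"
    then show "\<exists>y\<in>carrier (free_int_module S).
        y \<oplus>\<^bsub>free_int_module S\<^esub> x = \<zero>\<^bsub>free_int_module S\<^esub>"
      by (intro bexI[of _ "- x"]) (auto simp: free_int_module_def)
  qed (auto simp: free_int_module_def add_ac dest: subsetD[OF keys_add])
qed (auto simp: free_int_module_def frag_cmul_distrib frag_cmul_distrib2)

lemma carrier_chain_module:
  "carrier (chain_module X n) = {c. Poly_Mapping.keys c \<subseteq> {xs. length xs = n + 1 \<and> set xs \<subseteq> X}}"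
  by (simp add: chain_module_def free_int_module_def free_Abelian_group_def)

lemma chain_module_simps:
  "x \<oplus>\<^bsub>chain_module X n\<^esub> y = x + y"
  "r \<odot>\<^bsub>chain_module X n\<^esub> x = frag_cmul r x"
  "\<zero>\<^bsub>chain_module X n\<^esub> = 0"
  by (simp_all add: chain_module_def free_int_module_def)

lemma sum_in_chain_module:
  assumes "\<And>i. i \<in> I \<Longrightarrow> g i \<in> carrier (chain_module X n)"
  shows "(\<Sum>i\<in>I. frag_cmul (b i) (g i)) \<in> carrier (chain_module X n)"
proof -
  have "Poly_Mapping.keys (\<Sum>i\<in>I. frag_cmul (b i) (g i)) \<subseteq> (\<Union>i\<in>I. Poly_Mapping.keys (g i))"
    by (rule order_trans[OF keys_sum UN_mono[OF order_refl keys_cmul]])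
  also have "\<dots> \<subseteq> {xs. length xs = n + 1 \<and> set xs \<subseteq> X}"
    using assms unfolding carrier_chain_module by blast
  finally show ?thesis
    by (simp add: carrier_chain_module)
qed

text \<open>Serves twice: for the combination of faces over the operations, and for the alternating
  sum over face indices. Compatibility with scalars rests on commutativity of the integers.\<close>

lemma linear_maps_sum:
  assumes "\<And>j. j \<in> J \<Longrightarrow> h j \<in> linear_maps int_ring (chain_module X m) (chain_module X n)"
  shows "(\<lambda>c. \<Sum>j\<in>J. frag_cmul (b j) (h j c)) \<in>
    linear_maps int_ring (chain_module X m) (chain_module X n)"
proof -
  have h: "h j c \<in> carrier (chain_module X n)" "h j (c + c') = h j c + h j c'"
    "h j (frag_cmul r c) = frag_cmul r (h j c)"
    if "j \<in> J" "c \<in> carrier (chain_module X m)" "c' \<in> carrier (chain_module X m)" for j c c' r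
    using assms[OF that(1)] that(2,3) by (auto simp: linear_maps_def chain_module_simps)
  then have "(\<Sum>j\<in>J. frag_cmul (b j) (h j c)) \<in> carrier (chain_module X n)"
    if "c \<in> carrier (chain_module X m)" for c
    using that by (simp add: sum_in_chain_module)
  then show ?thesis
    by (simp add: linear_maps_def chain_module_simps h frag_cmul_distrib2 frag_cmul_sum
        sum.distrib mult.commute)
qed

lemma face_tuple_in:
  assumes "f \<in> Bin X" "i < length xs" "set xs \<subseteq> X"
  shows "set (face_tuple f i xs) \<subseteq> X"
proof -
  have "f y (xs ! i) \<in> X" if "y \<in> set (take i xs)" for y
    using assms that by (auto simp: Bin_def Pi_iff subset_iff dest!: in_set_takeD)
  then show ?thesis
    using assms set_drop_subset[of "i + 1" xs] by (auto simp: face_tuple_def)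
qed

lemma length_face_tuple:
  "i < length xs \<Longrightarrow> length (face_tuple f i xs) = length xs - 1"
  by (simp add: face_tuple_def)

lemma nth_face_tuple:
  assumes "i < length xs" "l < length xs - 1"
  shows "face_tuple f i xs ! l = (if l < i then f (xs ! l) (xs ! i) else xs ! (l + 1))"
  using assms by (auto simp: face_tuple_def nth_append)

text \<open>Compare entries. For l < i the two sides are the two sides of mixed distributivity. For
  i \<le> l < j - 1 both are \<open>g (xs ! (l + 1)) (xs ! j)\<close>, and from j - 1 on both are
  \<open>xs ! (l + 2)\<close>. Deleting entry i first moves entry j to position j - 1.\<close>

lemma face_tuple_face_tuple:
  assumes S: "distributive_set X S" "f \<in> S" "g \<in> S"
    and xs: "set xs \<subseteq> X" and ij: "i < j" "j < length xs"
  shows "face_tuple f i (face_tuple g j xs) = face_tuple g (j - 1) (face_tuple f i xs)"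
proof (rule nth_equalityI)
  fix l assume "l < length (face_tuple f i (face_tuple g j xs))"
  then have l: "l < length xs - 2"
    using ij by (simp add: length_face_tuple)
  have "xs ! l \<in> X" "xs ! i \<in> X" "xs ! j \<in> X"
    using xs ij l by (auto simp: subset_iff)
  then have "f (g (xs ! l) (xs ! j)) (g (xs ! i) (xs ! j)) = g (f (xs ! l) (xs ! i)) (xs ! j)"
    using S unfolding distributive_set_def by metis
  then show "face_tuple f i (face_tuple g j xs) ! l = face_tuple g (j - 1) (face_tuple f i xs) ! l"
    using ij l by (auto simp: nth_face_tuple length_face_tuple)
qed (use ij in \<open>simp add: length_face_tuple\<close>)

lemma face_linear:
  assumes "f \<in> Bin X" "i \<le> n + 1"
  shows "face f i \<in> linear_maps int_ring (chain_module X (n + 1)) (chain_module X n)"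
proof -
  have "face f i c \<in> carrier (chain_module X n)" if "c \<in> carrier (chain_module X (n + 1))" for c
  proof -
    have "face_tuple f i xs \<in> {ys. length ys = n + 1 \<and> set ys \<subseteq> X}"
      if "xs \<in> Poly_Mapping.keys c" for xs
    proof -
      \<comment> \<open>A point of degree n + 1 has n + 2 entries, so the index i \<le> n + 1 is in
        range.\<close>
      have "length xs = n + 2" "set xs \<subseteq> X"
        using that \<open>c \<in> _\<close> by (auto simp: carrier_chain_module)
      then show ?thesis
        using assms face_tuple_in[of f X i xs] by (simp add: length_face_tuple)
    qed
    then show ?thesis
      using keys_frag_extend[of "\<lambda>xs. frag_of (face_tuple f i xs)" c]
      by (fastforce simp: carrier_chain_module face_def)
  qed
  then show ?thesis
    by (simp add: linear_maps_def chain_module_simps face_def frag_extend_add frag_extend_cmul)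
qed

lemma face_face:
  assumes "distributive_set X S" "f \<in> S" "g \<in> S" "i < j" "j \<le> n + 2"
    and "c \<in> carrier (chain_module X (n + 2))"
  shows "face f i (face g j c) = face g (j - 1) (face f i c)"
proof -
  have "face_tuple f i (face_tuple g j xs) = face_tuple g (j - 1) (face_tuple f i xs)"
    if "xs \<in> Poly_Mapping.keys c" for xs
    using that assms by (intro face_tuple_face_tuple[of X S]) (auto simp: carrier_chain_module)
  \<comment> \<open>Linear extensions compose to the linear extension of the composite on tuples.
    Two such extensions agree on \<open>c\<close> once they agree on its support, whose tuples have
    entries in \<open>X\<close>.\<close>
  moreover have "face f p (face g q c) =
      frag_extend (\<lambda>xs. frag_of (face_tuple f p (face_tuple g q xs))) c" for f g p q
    using frag_extend_compose[of "\<lambda>xs. frag_of (face_tuple f p xs)" "face_tuple g q" c]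
    by (simp add: face_def o_def)
  ultimately show ?thesis
    by (auto intro: frag_extend_eq)
qed

lemma face_sum:
  "face f i (\<Sum>j\<in>J. frag_cmul (b j) (h j)) = (\<Sum>j\<in>J. frag_cmul (b j) (face f i (h j)))"
  by (cases "finite J") (simp_all add: face_def frag_extend_sum frag_extend_cmul)

lemma multi_face_sum:
  "multi_face k ops a i (\<Sum>j\<in>J. frag_cmul (b j) (h j)) =
    (\<Sum>j\<in>J. frag_cmul (b j) (multi_face k ops a i (h j)))"
  unfolding multi_face_def face_sum frag_cmul_sum
  by (subst sum.swap) (simp add: mult.commute)

text \<open>Interchanging the sums over operations and over face indices puts the boundary in the
  form that the cancellation argument needs.\<close>

lemma multi_boundary_eq:
  "multi_boundary k ops a n c = (\<Sum>i=0..n. frag_cmul ((-1) ^ i) (multi_face k ops a i c))"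
  unfolding multi_boundary_def boundary_def multi_face_def frag_cmul_sum
  by (subst sum.swap) (simp add: mult.commute)

lemma multi_face_multi_face:
  assumes "distributive_set X (ops ` {1..k})" "i < j" "j \<le> n + 2"
    and "c \<in> carrier (chain_module X (n + 2))"
  shows "multi_face k ops a i (multi_face k ops a j c) =
    multi_face k ops a (j - 1) (multi_face k ops a i c)"
proof -
  have "face (ops l) i (face (ops m) j c) = face (ops m) (j - 1) (face (ops l) i c)"
    if "l \<in> {1..k}" "m \<in> {1..k}" for l m
    using assms that by (intro face_face[of X "ops ` {1..k}"]) auto
  then show ?thesis
    \<comment> \<open>Both sides become double sums over pairs of operations. The mixed identity
      exchanges which operation acts first, so the summation order is swapped and the coefficients
      commuted.\<close>
    unfolding multi_face_def face_sum frag_cmul_sum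
    by (subst sum.swap) (simp add: mult.commute)
qed

theorem mainTheorem2:
  fixes X :: "'a set" and k :: nat and ops :: "nat \<Rightarrow> 'a \<Rightarrow> 'a \<Rightarrow> 'a" and a :: "nat \<Rightarrow> int"
  assumes "distributive_set X (ops ` {1..k})"
  shows "presimplicial_module int_ring (chain_module X) (\<lambda>n. multi_face k ops a) \<and>
         module_chain_complex int_ring (chain_module X) (multi_boundary k ops a)"
proof
  have "ops j \<in> Bin X" if "j \<in> {1..k}" for j
    using assms that by (auto simp: distributive_set_def)
  then have linear: "multi_face k ops a i \<in>
      linear_maps int_ring (chain_module X (n + 1)) (chain_module X n)" if "i \<le> n + 1" for n i
    using linear_maps_sum[of "{1..k}" "\<lambda>j. face (ops j) i"] face_linear that
    unfolding multi_face_def by blast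
  have mod: "module int_ring (chain_module X n)" for n
    by (simp add: chain_module_def module_free_int_module)
  show "presimplicial_module int_ring (chain_module X) (\<lambda>n. multi_face k ops a)"
    by (rule presimplicial_module.intro) (fact mod linear multi_face_multi_face[OF assms])+
  show "module_chain_complex int_ring (chain_module X) (multi_boundary k ops a)"
  proof (rule module_chain_complex.intro[OF mod])
    show "multi_boundary k ops a (n + 1) \<in>
        linear_maps int_ring (chain_module X (n + 1)) (chain_module X n)" for n
      unfolding multi_boundary_eq by (intro linear_maps_sum linear) simp
    fix n x assume x: "x \<in> carrier (chain_module X (n + 2))"
    \<comment> \<open>The inner bound n + 2 is written \<open>n+1+1\<close> to fit the cancellation
      lemma with m = n + 1.\<close>
    have "multi_boundary k ops a (n + 1) (multi_boundary k ops a (n + 2) x) =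
        (\<Sum>i=0..n+1. \<Sum>j=0..n+1+1. frag_cmul ((-1) ^ (i + j))
          (multi_face k ops a i (multi_face k ops a j x)))"
      by (simp add: multi_boundary_eq multi_face_sum frag_cmul_sum power_add
          del: sum.cl_ivl_Suc)
    also have "\<dots> = 0"
      using multi_face_multi_face[OF assms _ _ x] by (intro alternating_double_sum_eq_0) simp
    finally show "multi_boundary k ops a (n + 1) (multi_boundary k ops a (n + 2) x) =
        \<zero>\<^bsub>chain_module X n\<^esub>"
      by (simp add: chain_module_simps)
  qed
qed

end
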